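(* Let $p\in\mathbb{N}$, let $m_1,\dots,m_p\in\mathbb{N}$, and let $(M_{m_j}(t),N_{m_j}(t))$, $j=1,\dots,p$, be Luchko pairs of kernels from the sets $L_{m_j}$. Then the pair of kernels $$M_{\{m\},n}(t) = \left(M_{m_1} * \dots * M_{m_p}\right)(t), \quad N_{\{m\},n}(t) = \left(N_{m_1} * \dots * N_{m_p}\right)(t),$$ where $$\sum_{j=1}^{p} m_j = n,$$ belongs to the Luchko set $L_n$.
   Context: $C_{-1}(0,\infty)$ is the space of functions $f$ on $(0,\infty)$ that can be represented as $f(t)=t^p g(t)$ for $t>0$ with some real $p>-1$ and $g\in C[0,\infty)$. The symbol $*$ denotes the Laplace convolution $(f*g)(t)=\int_0^t f(t-\tau)g(\tau)\,d\tau$, $t>0$. $\{1\}$ is the function identically equal to $1$, and for $n\in\mathbb{N}$, $\{1\}^n$ is its $n$-fold convolution power, $\{1\}^n=h_n(t)=\frac{t^{n-1}}{(n-1)!}$. For $n\in\mathbb{N}$, the Luchko set $L_n$ is the set of pairs $(M(t),N(t))$ (Luchko pairs) with $M,N\in C_{-1}(0,\infty)$ such that $(M*N)(t)=\{1\}^n$ for all $t\in(0,\infty)$. The pairs are indexed by $j$: if $m_i=m_j$ for $i\ne j$, the pairs $(M_{m_i},N_{m_i})$ and $(M_{m_j},N_{m_j})$ need not coincide. *)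

theory Defs
  imports "HOL-Analysis.Analysis"
begin

text \<open>Functions on the open half-line are represented by total functions on the reals;
  their values at arguments \<open>t \<le> 0\<close> never matter.\<close>

definition C_minus1 :: "(real \<Rightarrow> real) set" where
  "C_minus1 = {f. \<exists>q>-1. \<exists>g. continuous_on {0..} g \<and> (\<forall>t>0. f t = t powr q * g t)}"

text \<open>Integrating over the open interval ensures that only values of \<open>f\<close> and \<open>g\<close> at positive
  arguments are used. The integrand may be singular at both end points, but for functions in
  \<^const>\<open>C_minus1\<close> it is Lebesgue integrable.\<close>

definition laplace_conv :: "(real \<Rightarrow> real) \<Rightarrow> (real \<Rightarrow> real) \<Rightarrow> real \<Rightarrow> real" where
  "laplace_conv f g t = (LBINT \<tau>:{0<..<t}. f (t - \<tau>) * g \<tau>)"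

text \<open>\<open>F 1 * \<dots> * F p\<close>, bracketed to the left; meaningful for \<open>p \<ge> 1\<close> only.\<close>

definition laplace_conv_prod :: "(nat \<Rightarrow> real \<Rightarrow> real) \<Rightarrow> nat \<Rightarrow> real \<Rightarrow> real" where
  "laplace_conv_prod F p = foldl laplace_conv (F 1) (map F [2..<p + 1])"

definition laplace_conv_power :: "(real \<Rightarrow> real) \<Rightarrow> nat \<Rightarrow> real \<Rightarrow> real" where
  "laplace_conv_power f n = laplace_conv_prod (\<lambda>_. f) n"

definition luchko_set :: "nat \<Rightarrow> ((real \<Rightarrow> real) \<times> (real \<Rightarrow> real)) set" where
  "luchko_set n = {(M, N). M \<in> C_minus1 \<and> N \<in> C_minus1 \<and>
     (\<forall>t>0. laplace_conv M N t = laplace_conv_power (\<lambda>_. 1) n t)}"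

lemma laplace_conv_prod_1: "laplace_conv_prod F 1 = F 1"
  by (simp add: laplace_conv_prod_def)

lemma laplace_conv_prod_Suc:
  "n \<ge> 1 \<Longrightarrow> laplace_conv_prod F (Suc n) = laplace_conv (laplace_conv_prod F n) (F (Suc n))"
  by (simp add: laplace_conv_prod_def)

lemma laplace_conv_power_one:
  assumes "n \<ge> 1" "t > 0"
  shows "laplace_conv_power (\<lambda>_. 1) n t = t ^ (n - 1) / fact (n - 1)"
  using assms
proof (induction n arbitrary: t rule: nat_induct_at_least)
  case base
  show ?case by (simp add: laplace_conv_power_def laplace_conv_prod_def)
next
  case (Suc n)
  have "laplace_conv_power (\<lambda>_. 1) (Suc n) t =
      (LBINT \<tau>:{0<..<t}. laplace_conv_power (\<lambda>_. 1) n (t - \<tau>))"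
    using Suc.hyps
    by (simp add: laplace_conv_power_def laplace_conv_prod_Suc laplace_conv_def)
  also have "\<dots> = (LBINT \<tau>:{0<..<t}. (t - \<tau>) ^ (n - 1) / fact (n - 1))"
    by (rule set_lebesgue_integral_cong) (auto simp: Suc.IH)
  also have "\<dots> = (LBINT \<tau>=0..t. (t - \<tau>) ^ (n - 1) / fact (n - 1))"
    using \<open>t > 0\<close> by (simp add: interval_lebesgue_integral_def zero_ereal_def)
  also have "\<dots> = - ((t - t) ^ n / fact n) - - ((t - 0) ^ n / fact n)"
    unfolding zero_ereal_def
  proof (rule interval_integral_FTC_finite)
    show "continuous_on {min 0 t..max 0 t} (\<lambda>\<tau>. (t - \<tau>) ^ (n - 1) / fact (n - 1))"
      by (intro continuous_intros) auto
    show "((\<lambda>\<tau>. - ((t - \<tau>) ^ n / fact n)) has_vector_derivative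
        (t - x) ^ (n - 1) / fact (n - 1)) (at x within {min 0 t..max 0 t})" for x
    proof -
      have "fact n = real n * fact (n - 1)"
        using Suc.hyps by (simp add: fact_reduce)
      then show ?thesis
        using Suc.hyps unfolding has_real_derivative_iff_has_vector_derivative[symmetric]
        by (auto intro!: derivative_eq_intros simp: field_simps)
    qed
  qed
  finally show ?case using Suc.hyps by (simp add: power_0_left)
qed

end

theory Submission
  imports Defs
begin

text \<open>
  On \<^const>\<open>C_minus1\<close> the Laplace convolution is a commutative and associative operation. Hence
  the product of two Luchko pairs can be rearranged as
  \<open>(M\<^sub>1 * M\<^sub>2) * (N\<^sub>1 * N\<^sub>2) = (M\<^sub>1 * N\<^sub>1) * (M\<^sub>2 * N\<^sub>2) = {1}\<^sup>m * {1}\<^sup>k = {1}\<^sup>m\<^sup>+\<^sup>k\<close>, and induction on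
  the number of pairs gives the theorem. The last equality is itself an instance of associativity,
  so no integral of powers has to be evaluated.

  All analysis thus lies in the claim that \<^const>\<open>C_minus1\<close> is closed under convolution
  (\<open>C_minus1_laplace_conv\<close>) and in associativity (\<open>laplace_conv_assoc\<close>). If \<open>f t = t powr q * a t\<close>
  and \<open>g t = t powr r * b t\<close>, the substitution \<open>\<tau> = t * s\<close> turns \<open>(f * g) t\<close> into
  \<open>t powr (q + r + 1)\<close> times the integral over \<open>s\<close> in \<open>(0, 1)\<close> of the fixed kernel
  \<open>s powr r * (1 - s) powr q\<close> against \<open>a (t * (1 - s)) * b (t * s)\<close>. The kernel is the integrand
  of the Beta function and integrable because \<open>q, r > -1\<close>; the other factor is continuous in
  \<open>(t, s)\<close>. So the integral converges and, by dominated convergence, depends continuously on \<open>t\<close>,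
  also at \<open>t = 0\<close>, while \<open>q + r + 1 > -1\<close>. Applied to \<open>\<bar>f\<bar>\<close>, \<open>\<bar>g\<bar>\<close>, \<open>\<bar>h\<bar>\<close>, this yields the
  absolute convergence under which Fubini's theorem gives associativity.
\<close>

section \<open>Functions with an integrable singularity at zero\<close>

text \<open>The continuous factor is extended to the negative half-line as a constant, so that continuity
  and measurability arguments need not mention the domain.\<close>

lemma C_minus1E:
  assumes "f \<in> C_minus1"
  obtains q g where "q > -1" "continuous_on UNIV g" "\<And>t. t > 0 \<Longrightarrow> f t = t powr q * g t"
proof -
  from assms obtain q g where q: "q > -1" and g: "continuous_on {0..} g"
    and f: "\<forall>t>0. f t = t powr q * g t"
    unfolding C_minus1_def by blast
  have "continuous_on UNIV (\<lambda>t. g (max 0 t))"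
    by (rule continuous_on_compose2[OF g]) (auto intro!: continuous_intros)
  with q f show ?thesis
    by (intro that[of q "\<lambda>t. g (max 0 t)"]) auto
qed

lemma C_minus1I:
  assumes "q > -1" "continuous_on UNIV g" "\<And>t. t > 0 \<Longrightarrow> f t = t powr q * g t"
  shows "f \<in> C_minus1"
  using assms continuous_on_subset[of UNIV g "{0..}"] unfolding C_minus1_def by blast

lemma C_minus1_const: "(\<lambda>_. c) \<in> C_minus1"
  by (rule C_minus1I[of 0 "\<lambda>_. c"]) auto

lemma C_minus1_abs:
  assumes "f \<in> C_minus1"
  shows "(\<lambda>t. \<bar>f t\<bar>) \<in> C_minus1"
proof -
  from assms obtain q g where "q > -1" "continuous_on UNIV g" "\<And>t. t > 0 \<Longrightarrow> f t = t powr q * g t"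
    by (rule C_minus1E) blast
  then show ?thesis
    by (intro C_minus1I[of q "\<lambda>t. \<bar>g t\<bar>"]) (auto intro!: continuous_intros simp: abs_mult)
qed

text \<open>Extension by zero to the whole line makes the Laplace convolution an ordinary convolution
  over \<^const>\<open>lborel\<close>, whose invariance under reflections and shifts then applies directly.\<close>

definition zero_ext :: "(real \<Rightarrow> real) \<Rightarrow> real \<Rightarrow> real" where
  "zero_ext f t = indicator {0<..} t * f t"

lemma zero_ext_abs: "\<bar>zero_ext f t\<bar> = zero_ext (\<lambda>t. \<bar>f t\<bar>) t"
  by (simp add: zero_ext_def indicator_def)

lemma borel_measurable_zero_ext:
  assumes "f \<in> C_minus1"
  shows "zero_ext f \<in> borel_measurable borel"
proof -
  from assms obtain q g where g: "continuous_on UNIV g" and f: "\<And>t. t > 0 \<Longrightarrow> f t = t powr q * g t"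
    by (rule C_minus1E) blast
  have [measurable]: "g \<in> borel_measurable borel"
    using g by (rule borel_measurable_continuous_onI)
  have "zero_ext f = (\<lambda>t. indicator {0<..} t * (t powr q * g t))"
    by (auto simp: zero_ext_def indicator_def f)
  then show ?thesis by simp
qed

lemma laplace_conv_eq_zero_ext:
  "laplace_conv f g t = (LINT \<tau>|lborel. zero_ext f (t - \<tau>) * zero_ext g \<tau>)"
  unfolding laplace_conv_def set_lebesgue_integral_def zero_ext_def
  by (rule Bochner_Integration.integral_cong) (auto simp: indicator_def)

lemma zero_ext_laplace_conv: "zero_ext (laplace_conv f g) = laplace_conv f g"
proof
  fix t
  show "zero_ext (laplace_conv f g) t = laplace_conv f g t"
    by (cases "t > 0") (simp_all add: zero_ext_def laplace_conv_def set_lebesgue_integral_def)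
qed

lemma laplace_conv_cong:
  assumes "\<And>t. t > 0 \<Longrightarrow> f t = f' t" "\<And>t. t > 0 \<Longrightarrow> g t = g' t"
  shows "laplace_conv f g = laplace_conv f' g'"
  unfolding laplace_conv_def fun_eq_iff
  by (auto intro!: set_lebesgue_integral_cong simp: assms)

section \<open>Convergence and regularity of the convolution\<close>

text \<open>On a bounded set of parameters \<open>t\<close>, compactness of \<open>[-T, T] \<times> [0, 1]\<close> bounds \<open>\<phi>\<close>, so
  that a multiple of \<open>\<bar>k\<bar>\<close> dominates the integrand.\<close>

lemma
  fixes \<phi> :: "real \<Rightarrow> real \<Rightarrow> real"
  assumes k: "integrable lborel k" and supp: "\<And>s. s \<notin> {0..1} \<Longrightarrow> k s = 0"
    and cont: "continuous_on UNIV (\<lambda>(t, s). \<phi> t s)"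
  shows integrable_kernel_times_continuous: "integrable lborel (\<lambda>s. k s * \<phi> t s)"
    and continuous_kernel_integral: "continuous_on UNIV (\<lambda>t. LINT s|lborel. k s * \<phi> t s)"
proof -
  have [measurable]: "k \<in> borel_measurable borel"
    using borel_measurable_integrable[OF k] by simp
  have cont_t: "continuous_on UNIV (\<phi> t)" for t
    using continuous_on_compose2[OF cont, of UNIV "\<lambda>s. (t, s)"]
    by (simp add: continuous_on_Pair continuous_on_const continuous_on_id)
  have cont_s: "continuous_on UNIV (\<lambda>t. \<phi> t s)" for s
    using continuous_on_compose2[OF cont, of UNIV "\<lambda>t. (t, s)"]
    by (simp add: continuous_on_Pair continuous_on_const continuous_on_id)
  have [measurable]: "\<phi> t \<in> borel_measurable borel" for t
    using cont_t by (rule borel_measurable_continuous_onI)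
  have bound: "\<exists>K\<ge>0. \<forall>t\<in>{-T..T}. \<forall>s. \<bar>k s * \<phi> t s\<bar> \<le> K * \<bar>k s\<bar>" for T
  proof -
    have "compact ((\<lambda>(t, s). \<phi> t s) ` ({-T..T} \<times> {0..1}))"
      by (intro compact_continuous_image continuous_on_subset[OF cont] compact_Times) auto
    then obtain K where K: "\<forall>y \<in> (\<lambda>(t, s). \<phi> t s) ` ({-T..T} \<times> {0..1}). norm y \<le> K"
      using compact_imp_bounded bounded_iff by metis
    have "\<bar>k s * \<phi> t s\<bar> \<le> max 0 K * \<bar>k s\<bar>" if "t \<in> {-T..T}" for t s
    proof (cases "s \<in> {0..1}")
      case True
      then have "\<bar>\<phi> t s\<bar> \<le> K" using K that by force
      then have "\<bar>\<phi> t s\<bar> \<le> max 0 K" by simp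
      then show ?thesis
        unfolding abs_mult by (subst mult.commute) (rule mult_right_mono, auto)
    qed (simp add: supp)
    then show ?thesis by (intro exI[of _ "max 0 K"]) auto
  qed
  show "integrable lborel (\<lambda>s. k s * \<phi> t s)" for t
  proof -
    obtain K where "K \<ge> 0" and K: "\<forall>u\<in>{-\<bar>t\<bar>..\<bar>t\<bar>}. \<forall>s. \<bar>k s * \<phi> u s\<bar> \<le> K * \<bar>k s\<bar>"
      using bound by blast
    have "t \<in> {-\<bar>t\<bar>..\<bar>t\<bar>}" by auto
    with K have K_t: "\<forall>s. \<bar>k s * \<phi> t s\<bar> \<le> K * \<bar>k s\<bar>" by blast
    show ?thesis
    proof (rule Bochner_Integration.integrable_bound)
      show "integrable lborel (\<lambda>s. K * \<bar>k s\<bar>)" using k by simp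
      show "AE s in lborel. norm (k s * \<phi> t s) \<le> norm (K * \<bar>k s\<bar>)"
        using K_t \<open>K \<ge> 0\<close> by (intro AE_I2) (simp add: abs_mult)
    qed simp
  qed
  show "continuous_on UNIV (\<lambda>t. LINT s|lborel. k s * \<phi> t s)"
  proof (subst continuous_on_sequentially, intro ballI allI impI, unfold comp_def, elim conjE)
    fix x :: "nat \<Rightarrow> real" and t :: real
    assume x: "x \<longlonglongrightarrow> t"
    obtain T where T: "\<And>n. \<bar>x n\<bar> \<le> T"
      using convergent_imp_Bseq[OF convergentI[OF x]] unfolding Bseq_def by auto
    obtain K where K: "\<forall>u\<in>{-T..T}. \<forall>s. \<bar>k s * \<phi> u s\<bar> \<le> K * \<bar>k s\<bar>"
      using bound by blast
    show "(\<lambda>n. LINT s|lborel. k s * \<phi> (x n) s) \<longlonglongrightarrow> (LINT s|lborel. k s * \<phi> t s)"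
    proof (rule integral_dominated_convergence)
      show "integrable lborel (\<lambda>s. K * \<bar>k s\<bar>)" using k by simp
      show "AE s in lborel. norm (k s * \<phi> (x n) s) \<le> K * \<bar>k s\<bar>" for n
        using K T[of n] by (intro AE_I2) (simp add: abs_le_iff)
      have "(\<lambda>n. \<phi> (x n) s) \<longlonglongrightarrow> \<phi> t s" for s
        using continuous_on_tendsto_compose[OF cont_s x] by simp
      then show "AE s in lborel. (\<lambda>n. k s * \<phi> (x n) s) \<longlonglongrightarrow> k s * \<phi> t s"
        by (intro AE_I2 tendsto_mult tendsto_const)
    qed simp_all
  qed
qed

definition beta_kernel :: "real \<Rightarrow> real \<Rightarrow> real \<Rightarrow> real" where
  "beta_kernel q r s = indicator {0<..<1} s * ((1 - s) powr q * s powr r)"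

lemma integrable_beta_kernel:
  assumes "q > -1" "r > -1"
  shows "integrable lborel (beta_kernel q r)"
proof -
  have "set_integrable lborel {0..1} (\<lambda>s. s powr (r + 1 - 1) * (1 - s) powr (q + 1 - 1))"
    using assms by (intro integrable_Beta) auto
  then have "set_integrable lborel {0<..<1} (\<lambda>s. s powr r * (1 - s) powr q)"
    unfolding add_diff_cancel_right' by (rule set_integrable_subset) auto
  then show ?thesis
    unfolding set_integrable_def beta_kernel_def[abs_def] by (simp add: mult.commute)
qed

text \<open>The integrand of the convolution after the substitution \<open>\<tau> = t * s\<close>.\<close>

lemma zero_ext_product_rescaled:
  assumes "t > 0"
    and f: "\<And>t. t > 0 \<Longrightarrow> f t = t powr q * a t" and g: "\<And>t. t > 0 \<Longrightarrow> g t = t powr r * b t"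
  shows "zero_ext f (t - t * s) * zero_ext g (t * s) =
    t powr (q + r) * (beta_kernel q r s * (a (t * (1 - s)) * b (t * s)))"
proof (cases "s \<in> {0<..<1}")
  case True
  then have "t * (1 - s) > 0" "t * s > 0" using \<open>t > 0\<close> by auto
  moreover have "t - t * s = t * (1 - s)" by (simp add: algebra_simps)
  ultimately have "zero_ext f (t - t * s) = (t * (1 - s)) powr q * a (t * (1 - s))"
    "zero_ext g (t * s) = (t * s) powr r * b (t * s)"
    by (simp_all add: zero_ext_def f g del: zero_less_mult_iff)
  with True \<open>t > 0\<close> show ?thesis
    by (simp add: beta_kernel_def powr_mult powr_add mult_ac)
next
  case False
  then have "\<not> (t - t * s > 0 \<and> t * s > 0)"
    using \<open>t > 0\<close> by (auto simp: zero_less_mult_iff)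
  then have "zero_ext f (t - t * s) * zero_ext g (t * s) = 0"
    by (auto simp: zero_ext_def)
  with False show ?thesis by (simp add: beta_kernel_def)
qed

lemma continuous_rescaled_factors:
  fixes a b :: "real \<Rightarrow> real"
  assumes "continuous_on UNIV a" "continuous_on UNIV b"
  shows "continuous_on UNIV (\<lambda>(t, s). a (t * (1 - s)) * b (t * s))"
  unfolding case_prod_beta
  by (intro continuous_on_mult continuous_on_compose2[OF assms(1)] continuous_on_compose2[OF assms(2)]
      continuous_intros) auto

lemma integrable_laplace_conv:
  assumes "f \<in> C_minus1" "g \<in> C_minus1"
  shows "integrable lborel (\<lambda>\<tau>. zero_ext f (t - \<tau>) * zero_ext g \<tau>)"
proof (cases "t > 0")
  case True
  from assms(1) obtain q a where q: "q > -1" "continuous_on UNIV a"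
    and f: "\<And>t. t > 0 \<Longrightarrow> f t = t powr q * a t" by (rule C_minus1E) blast
  from assms(2) obtain r b where r: "r > -1" "continuous_on UNIV b"
    and g: "\<And>t. t > 0 \<Longrightarrow> g t = t powr r * b t" by (rule C_minus1E) blast
  have "integrable lborel (\<lambda>s. beta_kernel q r s * (a (t * (1 - s)) * b (t * s)))"
    using q r
    by (intro integrable_kernel_times_continuous[where \<phi> = "\<lambda>t s. a (t * (1 - s)) * b (t * s)"]
        integrable_beta_kernel continuous_rescaled_factors) (auto simp: beta_kernel_def)
  then have "integrable lborel (\<lambda>s. zero_ext f (t - t * s) * zero_ext g (t * s))"
    by (simp add: zero_ext_product_rescaled[OF True f g])
  then show ?thesis
    using True lborel_integrable_real_affine_iff[of t "\<lambda>\<tau>. zero_ext f (t - \<tau>) * zero_ext g \<tau>" 0]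
    by simp
next
  case False
  then have "(\<lambda>\<tau>. zero_ext f (t - \<tau>) * zero_ext g \<tau>) = (\<lambda>_. 0)"
    by (auto simp: zero_ext_def indicator_def)
  then show ?thesis by simp
qed

lemma C_minus1_laplace_conv:
  assumes "f \<in> C_minus1" "g \<in> C_minus1"
  shows "laplace_conv f g \<in> C_minus1"
proof -
  from assms(1) obtain q a where q: "q > -1" "continuous_on UNIV a"
    and f: "\<And>t. t > 0 \<Longrightarrow> f t = t powr q * a t" by (rule C_minus1E) blast
  from assms(2) obtain r b where r: "r > -1" "continuous_on UNIV b"
    and g: "\<And>t. t > 0 \<Longrightarrow> g t = t powr r * b t" by (rule C_minus1E) blast
  define G where "G t = (LINT s|lborel. beta_kernel q r s * (a (t * (1 - s)) * b (t * s)))" for t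
  have "continuous_on UNIV G"
    unfolding G_def using q r
    by (intro continuous_kernel_integral[where \<phi> = "\<lambda>t s. a (t * (1 - s)) * b (t * s)"]
        integrable_beta_kernel continuous_rescaled_factors) (auto simp: beta_kernel_def)
  moreover have "laplace_conv f g t = t powr (q + r + 1) * G t" if "t > 0" for t
  proof -
    have "laplace_conv f g t = t * (LINT s|lborel. zero_ext f (t - t * s) * zero_ext g (t * s))"
      unfolding laplace_conv_eq_zero_ext
      using that lborel_integral_real_affine[of t "\<lambda>\<tau>. zero_ext f (t - \<tau>) * zero_ext g \<tau>" 0]
      by simp
    also have "\<dots> = t * (t powr (q + r) * G t)"
      by (simp add: zero_ext_product_rescaled[OF that f g] G_def)
    finally show ?thesis using that by (simp add: powr_add)
  qed
  moreover have "q + r + 1 > -1" using q r by simp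
  ultimately show ?thesis by (intro C_minus1I)
qed

section \<open>Commutativity and associativity\<close>

lemma laplace_conv_commute: "laplace_conv f g = laplace_conv g f"
proof
  fix t
  show "laplace_conv f g t = laplace_conv g f t"
    unfolding laplace_conv_eq_zero_ext
    using lborel_integral_real_affine[of "-1" "\<lambda>\<tau>. zero_ext f (t - \<tau>) * zero_ext g \<tau>" t]
    by (simp add: mult.commute)
qed

text \<open>Both sides are iterated integrals of \<open>f (t - s) * g (s - u) * h u\<close> with the factors extended
  by zero, the left one after a shift of the inner variable by \<open>u\<close>. This function of
  \<open>(s, u)\<close> is absolutely integrable because its modulus has as iterated integral the convolution
  of \<open>\<bar>f\<bar>\<close> with \<open>\<bar>g\<bar> * \<bar>h\<bar>\<close>, both of which lie in \<^const>\<open>C_minus1\<close>.\<close>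

lemma laplace_conv_assoc:
  assumes "f \<in> C_minus1" "g \<in> C_minus1" "h \<in> C_minus1"
  shows "laplace_conv (laplace_conv f g) h = laplace_conv f (laplace_conv g h)"
proof
  fix t
  note [measurable] = assms[THEN borel_measurable_zero_ext]
  let ?F = "\<lambda>s u. zero_ext f (t - s) * (zero_ext g (s - u) * zero_ext h u)"
  have "integrable (lborel \<Otimes>\<^sub>M lborel) (case_prod ?F)"
  proof (rule lborel_pair.Fubini_integrable)
    show "case_prod ?F \<in> borel_measurable (lborel \<Otimes>\<^sub>M lborel)" by measurable
    have "(LINT u|lborel. norm (case_prod ?F (s, u))) =
        zero_ext (\<lambda>x. \<bar>f x\<bar>) (t - s) * zero_ext (laplace_conv (\<lambda>x. \<bar>g x\<bar>) (\<lambda>x. \<bar>h x\<bar>)) s" for s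
      unfolding zero_ext_laplace_conv laplace_conv_eq_zero_ext
      by (simp add: abs_mult zero_ext_abs)
    then show "integrable lborel (\<lambda>s. LINT u|lborel. norm (case_prod ?F (s, u)))"
      using assms by (simp only:) (intro integrable_laplace_conv C_minus1_laplace_conv C_minus1_abs)
    show "AE s in lborel. integrable lborel (\<lambda>u. case_prod ?F (s, u))"
      using integrable_laplace_conv[OF assms(2,3)] by (intro AE_I2) simp
  qed
  then have swap: "(LINT u|lborel. LINT s|lborel. ?F s u) = (LINT s|lborel. LINT u|lborel. ?F s u)"
    by (rule lborel_pair.Fubini_integral)
  have inner: "laplace_conv f g (t - u) * zero_ext h u = (LINT s|lborel. ?F s u)" for u
  proof -
    have "laplace_conv f g (t - u) = (LINT s|lborel. zero_ext f (t - s) * zero_ext g (s - u))"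
      unfolding laplace_conv_eq_zero_ext
      using lborel_integral_real_affine[of 1 "\<lambda>s. zero_ext f (t - s) * zero_ext g (s - u)" u]
      by (simp add: algebra_simps)
    then show ?thesis by (simp flip: mult.assoc)
  qed
  have "laplace_conv (laplace_conv f g) h t = (LINT u|lborel. LINT s|lborel. ?F s u)"
    unfolding laplace_conv_eq_zero_ext[of "laplace_conv f g"] zero_ext_laplace_conv inner ..
  also have "\<dots> = laplace_conv f (laplace_conv g h) t"
    unfolding swap laplace_conv_eq_zero_ext[of f "laplace_conv g h"] zero_ext_laplace_conv
    by (simp add: laplace_conv_eq_zero_ext)
  finally show "laplace_conv (laplace_conv f g) h t = laplace_conv f (laplace_conv g h) t" .
qed

lemma laplace_conv_interchange:
  assumes "a \<in> C_minus1" "b \<in> C_minus1" "c \<in> C_minus1" "d \<in> C_minus1"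
  shows "laplace_conv (laplace_conv a c) (laplace_conv b d) =
    laplace_conv (laplace_conv a b) (laplace_conv c d)"
proof -
  have "laplace_conv c (laplace_conv b d) = laplace_conv b (laplace_conv c d)"
    using assms laplace_conv_assoc[of c b d] laplace_conv_assoc[of b c d] laplace_conv_commute[of b c]
    by simp
  with assms show ?thesis by (simp add: laplace_conv_assoc C_minus1_laplace_conv)
qed

section \<open>Products of Luchko pairs\<close>

lemma C_minus1_laplace_conv_power:
  assumes "f \<in> C_minus1" "n \<ge> 1"
  shows "laplace_conv_power f n \<in> C_minus1"
  using assms(2) unfolding laplace_conv_power_def
  by (induction n rule: nat_induct_at_least)
    (simp_all add: laplace_conv_prod_1[simplified] laplace_conv_prod_Suc C_minus1_laplace_conv assms(1))

lemma laplace_conv_power_add: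
  assumes "f \<in> C_minus1" "m \<ge> 1" "k \<ge> 1"
  shows "laplace_conv_power f (m + k) = laplace_conv (laplace_conv_power f m) (laplace_conv_power f k)"
  using assms(3)
proof (induction k rule: nat_induct_at_least)
  case base
  show ?case
    using assms(2) by (simp add: laplace_conv_power_def laplace_conv_prod_Suc laplace_conv_prod_1[simplified])
next
  case (Suc k)
  have step: "laplace_conv_power f (Suc n) = laplace_conv (laplace_conv_power f n) f" if "n \<ge> 1" for n
    using that by (simp add: laplace_conv_power_def laplace_conv_prod_Suc)
  show ?case
    using Suc assms by (simp add: step laplace_conv_assoc C_minus1_laplace_conv_power)
qed

lemma luchko_set_laplace_conv:
  assumes "m \<ge> 1" "k \<ge> 1" and "(A, B) \<in> luchko_set m" "(C, D) \<in> luchko_set k"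
  shows "(laplace_conv A C, laplace_conv B D) \<in> luchko_set (m + k)"
proof -
  let ?h = "laplace_conv_power (\<lambda>_. 1)"
  have AB: "A \<in> C_minus1" "B \<in> C_minus1" "\<And>t. t > 0 \<Longrightarrow> laplace_conv A B t = ?h m t"
    and CD: "C \<in> C_minus1" "D \<in> C_minus1" "\<And>t. t > 0 \<Longrightarrow> laplace_conv C D t = ?h k t"
    using assms(3,4) by (auto simp: luchko_set_def)
  have "laplace_conv (laplace_conv A C) (laplace_conv B D) =
      laplace_conv (laplace_conv A B) (laplace_conv C D)"
    using AB CD by (intro laplace_conv_interchange)
  also have "\<dots> = laplace_conv (?h m) (?h k)"
    using AB CD by (intro laplace_conv_cong)
  also have "\<dots> = ?h (m + k)"
    using assms(1,2) by (simp add: laplace_conv_power_add C_minus1_const)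
  finally show ?thesis
    using AB CD by (simp add: luchko_set_def C_minus1_laplace_conv)
qed

theorem theorem4:
  fixes p n :: nat and m :: "nat \<Rightarrow> nat" and M N :: "nat \<Rightarrow> real \<Rightarrow> real"
  assumes "p \<ge> 1"
    and "\<forall>j\<in>{1..p}. m j \<ge> 1"
    and "\<forall>j\<in>{1..p}. (M j, N j) \<in> luchko_set (m j)"
    and "(\<Sum>j=1..p. m j) = n"
  shows "(laplace_conv_prod M p, laplace_conv_prod N p) \<in> luchko_set n"
  using assms
proof (induction p arbitrary: n rule: nat_induct_at_least)
  case base
  then show ?case by (simp add: laplace_conv_prod_1[simplified])
next
  case (Suc p)
  \<comment> \<open>The exponent must be positive, since \<open>{1}\<^sup>0\<close> is not a neutral element of convolution.\<close>
  have "m 1 \<le> (\<Sum>j=1..p. m j)"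
    using Suc.hyps by (intro member_le_sum) auto
  moreover have "m 1 \<ge> 1" using Suc.prems(1) by simp
  ultimately have "(\<Sum>j=1..p. m j) \<ge> 1" by linarith
  moreover have "(laplace_conv_prod M p, laplace_conv_prod N p) \<in> luchko_set (\<Sum>j=1..p. m j)"
    using Suc.prems by (intro Suc.IH) auto
  ultimately have "(laplace_conv_prod M (Suc p), laplace_conv_prod N (Suc p))
      \<in> luchko_set ((\<Sum>j=1..p. m j) + m (Suc p))"
    unfolding laplace_conv_prod_Suc[OF Suc.hyps]
    using Suc.prems by (intro luchko_set_laplace_conv) auto
  then show ?case using Suc.prems(3) by simp
qed

end
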